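(* Let $f$ be a relation on a paracompact, locally compact, Hausdorff space $X$ and let $\mathcal U_M$ be the uniformity of all neighborhoods of the diagonal. (a) If $X$ is $\sigma$-compact, then $1_X\cup\mathcal Gf=1_X\cup\mathcal A_{\mathcal U_M}f$. If, in addition, $f$ is cusc, then $\mathcal Gf=\mathcal A_{\mathcal U_M}f$. (b) If $f$ is a proper relation, then $\mathcal Gf=\mathcal A_{\mathcal U_M}f$.
   Context: A relation on $X$ is a subset of $X\times X$; $f(x)=\{y:(x,y)\in f\}$; $f^{-1}=\{(y,x):(x,y)\in f\}$; $1_X$ is the diagonal. $\mathcal Gf$ is the smallest closed transitive relation on $X$ containing $f$. The gage $\Gamma(\mathcal U)$ of a uniformity $\mathcal U$ is the set of all bounded pseudo-metrics $d$ on $X$ with $\{(x,y):d(x,y)<\epsilon\}\in\mathcal U$ for every $\epsilon>0$ (for $\mathcal U_M$ these are all bounded continuous pseudo-metrics). $\mathcal A_{\mathcal U}f$ is the set of pairs $(x,y)$ such that for every $d\in\Gamma(\mathcal U)$ and $\epsilon>0$ there are $n\ge1$ and $(a_1,b_1),\dots,(a_n,b_n)\in f$ with $d(x,a_1)+\sum_{i=1}^{n-1}d(b_i,a_{i+1})+d(b_n,y)<\epsilon$. $f$ is cusc (compactly upper semicontinuous) if $f(x)$ is compact for every $x\in X$ and $f^{-1}(B)=\{x:f(x)\cap B\neq\emptyset\}$ is closed for every closed $B\subset X$. $f$ is a proper relation if both $f$ and $f^{-1}$ are cusc. *)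

theory Defs
  imports "HOL-Analysis.Analysis"
begin

section \<open>Topological notions\<close>

definition paracompact_space :: "'a topology \<Rightarrow> bool" where
  "paracompact_space X \<longleftrightarrow>
     (\<forall>\<U>. (\<forall>U\<in>\<U>. openin X U) \<and> \<Union>\<U> = topspace X \<longrightarrow>
        (\<exists>\<V>. (\<forall>V\<in>\<V>. openin X V) \<and> \<Union>\<V> = topspace X \<and>
             (\<forall>V\<in>\<V>. \<exists>U\<in>\<U>. V \<subseteq> U) \<and> locally_finite_in X \<V>))"

definition sigma_compact_space :: "'a topology \<Rightarrow> bool" where
  "sigma_compact_space X \<longleftrightarrow>
     (\<exists>\<K>. countable \<K> \<and> (\<forall>K\<in>\<K>. compactin X K) \<and> \<Union>\<K> = topspace X)"

section \<open>Relations on a topological space\<close>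

text \<open>A relation on \<open>X\<close> is a set \<open>f \<subseteq> topspace X \<times> topspace X\<close>. The set \<open>f(x)\<close> is
  \<open>f `` {x}\<close>, and the preimage of \<open>B\<close>, the set of all \<open>x\<close> such that \<open>f(x)\<close> meets \<open>B\<close>,
  is \<open>f\<inverse> `` B\<close>.\<close>

definition cusc :: "'a topology \<Rightarrow> ('a \<times> 'a) set \<Rightarrow> bool" where
  "cusc X f \<longleftrightarrow>
     (\<forall>x\<in>topspace X. compactin X (f `` {x})) \<and>
     (\<forall>B. closedin X B \<longrightarrow> closedin X (f\<inverse> `` B))"

definition proper_relation :: "'a topology \<Rightarrow> ('a \<times> 'a) set \<Rightarrow> bool" where
  "proper_relation X f \<longleftrightarrow> cusc X f \<and> cusc X (f\<inverse>)"

definition closed_trancl :: "'a topology \<Rightarrow> ('a \<times> 'a) set \<Rightarrow> ('a \<times> 'a) set" where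
  "closed_trancl X f = \<Inter>{R. closedin (prod_topology X X) R \<and> trans R \<and> f \<subseteq> R}"

lemma closed_trancl_least:
  assumes "f \<subseteq> topspace X \<times> topspace X"
  shows "closedin (prod_topology X X) (closed_trancl X f)" "trans (closed_trancl X f)"
    "f \<subseteq> closed_trancl X f"
    "\<And>R. closedin (prod_topology X X) R \<Longrightarrow> trans R \<Longrightarrow> f \<subseteq> R \<Longrightarrow> closed_trancl X f \<subseteq> R"
proof -
  let ?S = "{R. closedin (prod_topology X X) R \<and> trans R \<and> f \<subseteq> R}"
  have "trans (topspace X \<times> topspace X)"
    by (auto intro: transI)
  then have "topspace X \<times> topspace X \<in> ?S"
    using assms closedin_topspace[of "prod_topology X X"] by simp
  then have "?S \<noteq> {}"
    by blast
  then show "closedin (prod_topology X X) (closed_trancl X f)"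
    unfolding closed_trancl_def by (intro closedin_Inter) auto
  show "trans (closed_trancl X f)"
    unfolding closed_trancl_def trans_def by blast
qed (auto simp: closed_trancl_def)

section \<open>Uniformities, gages and chains\<close>

text \<open>A uniformity on \<open>S\<close> is represented by its set of entourages. The distribution only has
  uniformities as a type class; here they live on an arbitrary carrier.\<close>

text \<open>The neighborhoods of the diagonal form a uniformity when \<open>X\<close> is paracompact Hausdorff,
  although not for arbitrary \<open>X\<close>.\<close>

definition diagonal_nbhds :: "'a topology \<Rightarrow> ('a \<times> 'a) set set" where
  "diagonal_nbhds X =
     {U. U \<subseteq> topspace X \<times> topspace X \<and>
         (\<exists>W. openin (prod_topology X X) W \<and> Id_on (topspace X) \<subseteq> W \<and> W \<subseteq> U)}"

text \<open>As in the library locale \<open>Metric_space\<close>, the distance is a total function whose values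
  outside the carrier are irrelevant, except that here distinct points may have distance 0.\<close>

definition pseudo_metric_on :: "'a set \<Rightarrow> ('a \<Rightarrow> 'a \<Rightarrow> real) \<Rightarrow> bool" where
  "pseudo_metric_on S d \<longleftrightarrow>
     (\<forall>x\<in>S. \<forall>y\<in>S. 0 \<le> d x y) \<and>
     (\<forall>x\<in>S. d x x = 0) \<and>
     (\<forall>x\<in>S. \<forall>y\<in>S. d x y = d y x) \<and>
     (\<forall>x\<in>S. \<forall>y\<in>S. \<forall>z\<in>S. d x z \<le> d x y + d y z)"

definition gage :: "'a set \<Rightarrow> ('a \<times> 'a) set set \<Rightarrow> ('a \<Rightarrow> 'a \<Rightarrow> real) set" where
  "gage S \<U> =
     {d. pseudo_metric_on S d \<and> (\<exists>B. \<forall>x\<in>S. \<forall>y\<in>S. d x y \<le> B) \<and>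
         (\<forall>\<epsilon>>0. {(x, y). x \<in> S \<and> y \<in> S \<and> d x y < \<epsilon>} \<in> \<U>)}"

definition chain_relation ::
    "'a set \<Rightarrow> ('a \<times> 'a) set set \<Rightarrow> ('a \<times> 'a) set \<Rightarrow> ('a \<times> 'a) set" where
  "chain_relation S \<U> f =
     {(x, y). x \<in> S \<and> y \<in> S \<and>
        (\<forall>d\<in>gage S \<U>. \<forall>\<epsilon>>0. \<exists>n\<ge>1. \<exists>a b :: nat \<Rightarrow> 'a.
           (\<forall>i\<in>{1..n}. (a i, b i) \<in> f) \<and>
           d x (a 1) + (\<Sum>i = 1..<n. d (b i) (a (i + 1))) + d (b n) y < \<epsilon>)}"

end

theory Submission
  imports Defs
begin

text \<open>
  The relation \<open>R = 1 \<union> \<G>f\<close> is a closed preorder. If \<open>(x, y) \<notin> R\<close>, a continuous function \<open>L\<close>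
  that increases along \<open>R\<close> with \<open>L x = 1\<close> and \<open>L y = 0\<close> gives the continuous pseudo-metric
  \<open>d(u, v) = \<bar>L u - L v\<bar>\<close>. Since \<open>L\<close> never decreases along \<open>f\<close>, the jumps of a chain from \<open>x\<close> to
  \<open>y\<close> add up to at least \<open>1\<close>, so \<open>(x, y) \<notin> \<A>f\<close>. On a \<open>\<sigma>\<close>-compact space such an \<open>L\<close> comes from
  Urysohn's construction with down-closed sets, because a closed preorder on a union of compact
  sets \<open>K\<^sub>n \<subseteq> int K\<^sub>n\<^sub>+\<^sub>1\<close> separates disjoint closed down- and up-sets (Nachbin): one enlarges
  disjoint compact neighborhoods from \<open>K\<^sub>n\<close> to \<open>K\<^sub>n\<^sub>+\<^sub>1\<close> step by step.

  For a proper relation, start from a point and alternately add images, preimages and the members of a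
  locally finite cover by relatively compact open sets. The union is a clopen, \<open>\<sigma>\<close>-compact set that
  \<open>f\<close> neither enters nor leaves, and \<open>L\<close> is extended by the constant \<open>1\<close>.
\<close>

section \<open>Compact exhaustions\<close>

lemma closedin_converse:
  assumes "closedin (prod_topology X Y) R"
  shows "closedin (prod_topology Y X) (R\<inverse>)"
proof -
  have "continuous_map (prod_topology Y X) (prod_topology X Y) (\<lambda>p. (snd p, fst p))"
    by (intro continuous_intros)
  from closedin_continuous_map_preimage[OF this assms]
  have "closedin (prod_topology Y X) {p \<in> topspace (prod_topology Y X). (snd p, fst p) \<in> R}" .
  moreover have "{p \<in> topspace (prod_topology Y X). (snd p, fst p) \<in> R} = R\<inverse>"
    using closedin_subset[OF assms] by auto
  ultimately show ?thesis by simp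
qed

lemma compactin_closed_relation_image:
  assumes "closedin (prod_topology X Y) R" "compactin X C" "compactin Y K"
  shows "compactin Y (R `` C \<inter> K)"
proof -
  have "compactin (prod_topology X Y) (R \<inter> C \<times> K)"
    using assms by (intro closed_Int_compactin) (auto simp: compactin_Times)
  from image_compactin[OF this continuous_map_snd]
  have "compactin Y (snd ` (R \<inter> C \<times> K))" .
  moreover have "snd ` (R \<inter> C \<times> K) = R `` C \<inter> K" by force
  ultimately show ?thesis by simp
qed

text \<open>Tube argument: for \<open>y\<close> outside the image, \<open>K \<times> {y}\<close> is
  a compact box inside the open complement of \<open>R\<close>, so Wallace's theorem thickens it to
  an open box that \<open>R\<close> still misses.\<close>

lemma closedin_relation_image_compact:
  assumes R: "closedin (prod_topology X Y) R" and K: "compactin X K"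
  shows "closedin Y (R `` K)"
proof -
  have "\<exists>V. openin Y V \<and> y \<in> V \<and> V \<subseteq> topspace Y - R `` K" if y: "y \<in> topspace Y - R `` K" for y
  proof -
    have "openin (prod_topology X Y) (topspace (prod_topology X Y) - R)" using R by blast
    moreover have "K \<times> {y} \<subseteq> topspace (prod_topology X Y) - R"
      using y compactin_subset_topspace[OF K] by auto
    moreover have "compactin Y {y}" using y by simp
    ultimately obtain U V where UV: "openin X U" "openin Y V" "K \<subseteq> U" "{y} \<subseteq> V"
      "U \<times> V \<subseteq> topspace (prod_topology X Y) - R"
      using Wallace_theorem_prod_topology[OF K] by metis
    then show ?thesis using openin_subset[of Y V] by (intro exI[of _ V]) blast
  qed
  then have "openin Y (topspace Y - R `` K)" by (subst openin_subopen) blast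
  moreover have "R `` K \<subseteq> topspace Y" using closedin_subset[OF R] by auto
  ultimately show ?thesis by (simp add: closedin_def)
qed

text \<open>An open subspace of a locally compact Hausdorff space is again one, so the compact
  neighborhood of \<open>P\<close> can be found inside \<open>N\<close>.\<close>

lemma compact_neighbourhood_within:
  assumes X: "locally_compact_space X" "Hausdorff_space X"
    and P: "compactin X P" and N: "openin X N" and "P \<subseteq> N"
  obtains U C where "openin X U" "compactin X C" "P \<subseteq> U" "U \<subseteq> C" "C \<subseteq> N"
proof -
  have "locally_compact_space (subtopology X N)" "Hausdorff_space (subtopology X N)"
    using X N by (auto intro: locally_compact_space_open_subset Hausdorff_space_subtopology)
  moreover have "compactin (subtopology X N) P"
    using P \<open>P \<subseteq> N\<close> by (simp add: compactin_subtopology)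
  ultimately obtain U C where "openin (subtopology X N) U" "compactin (subtopology X N) C" "P \<subseteq> U" "U \<subseteq> C"
    using locally_compact_space_compact_closed_compact[of "subtopology X N"] by metis
  then show thesis
    using that N by (metis compactin_subtopology openin_trans_full)
qed

text \<open>The union of the \<open>K n\<close> is left free: it may be the whole space or only a
  piece of it, as happens for proper relations.\<close>

definition compact_exhaustion :: "'a topology \<Rightarrow> (nat \<Rightarrow> 'a set) \<Rightarrow> bool" where
  "compact_exhaustion X K \<longleftrightarrow>
     (\<forall>n. compactin X (K n) \<and> (\<exists>U. openin X U \<and> K n \<subseteq> U \<and> U \<subseteq> K (Suc n)))"

lemma compact_exhaustion_mono:
  assumes "compact_exhaustion X K" "m \<le> n"
  shows "K m \<subseteq> K n"
  using assms(1) by (intro lift_Suc_mono_le[OF _ assms(2)]) (auto simp: compact_exhaustion_def)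

lemma sigma_compact_imp_compact_exhaustion:
  assumes X: "locally_compact_space X" "Hausdorff_space X" and "sigma_compact_space X"
  obtains K where "compact_exhaustion X K" "(\<Union>n. K n) = topspace X"
proof -
  obtain \<K> where \<K>: "countable \<K>" "\<And>K. K \<in> \<K> \<Longrightarrow> compactin X K" "\<Union>\<K> = topspace X"
    using assms(3) by (auto simp: sigma_compact_space_def)
  \<comment> \<open>Inserting \<open>{}\<close> makes the family nonempty, so that all natural
    numbers can enumerate it.\<close>
  define D where "D = from_nat_into (insert {} \<K>)"
  have D: "range D = insert {} \<K>"
    unfolding D_def using \<K>(1) by (intro range_from_nat_into) auto
  have Dc: "compactin X (D n)" for n
    using \<K>(2) D rangeI[of D n] by auto
  have "\<exists>L. \<forall>K. compactin X K \<longrightarrow> (\<exists>U. openin X U \<and> K \<subseteq> U \<and> U \<subseteq> L K) \<and> compactin X (L K)"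
    by (intro choice) (metis X compact_neighbourhood_within openin_topspace compactin_subset_topspace)
  then obtain L where L: "\<And>K. compactin X K \<Longrightarrow> \<exists>U. openin X U \<and> K \<subseteq> U \<and> U \<subseteq> L K"
    "\<And>K. compactin X K \<Longrightarrow> compactin X (L K)" by metis
  \<comment> \<open>Each stage absorbs the next set \<open>D n\<close> before passing to a compact
    neighborhood, so the stages exhaust the space.\<close>
  define K where "K = rec_nat {} (\<lambda>n C. L (C \<union> D n))"
  have K: "K 0 = {}" "K (Suc n) = L (K n \<union> D n)" for n by (auto simp: K_def)
  have Kc: "compactin X (K n)" for n
    by (induction n) (auto simp: K intro!: L(2) compactin_Un Dc)
  have *: "\<exists>U. openin X U \<and> K n \<union> D n \<subseteq> U \<and> U \<subseteq> K (Suc n)" for n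
    unfolding K using L(1)[OF compactin_Un[OF Kc Dc]] by blast
  have "D n \<subseteq> K (Suc n)" for n using *[of n] by blast
  then have "(\<Union>n. D n) \<subseteq> (\<Union>n. K n)" by blast
  moreover have "(\<Union>n. D n) = topspace X" using D \<K>(3) by simp
  moreover have "(\<Union>n. K n) \<subseteq> topspace X" using compactin_subset_topspace[OF Kc] by auto
  ultimately have "(\<Union>n. K n) = topspace X" by simp
  moreover have "\<exists>U. openin X U \<and> K n \<subseteq> U \<and> U \<subseteq> K (Suc n)" for n
    using *[of n] by auto
  then have "compact_exhaustion X K"
    unfolding compact_exhaustion_def using Kc by auto
  ultimately show thesis using that by blast
qed

text \<open>The set \<open>U\<close> is controlled only inside \<open>K (Suc n)\<close>.
  Intersecting it with an open set between \<open>K n\<close> and \<open>K (Suc n)\<close> gives an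
  open set between \<open>P n\<close> and \<open>P (Suc n)\<close>.\<close>

lemma openin_Union_exhausted:
  assumes "compact_exhaustion X K" "\<And>n. P n \<subseteq> K n"
    and "\<And>n. \<exists>U. openin X U \<and> P n \<subseteq> U \<and> U \<inter> K (Suc n) \<subseteq> P (Suc n)"
  shows "openin X (\<Union>n. P n)"
proof (subst openin_subopen, intro ballI)
  fix x assume "x \<in> (\<Union>n. P n)"
  then obtain n where n: "x \<in> P n" by auto
  obtain U where U: "openin X U" "P n \<subseteq> U" "U \<inter> K (Suc n) \<subseteq> P (Suc n)"
    using assms(3)[of n] by auto
  obtain W where W: "openin X W" "K n \<subseteq> W" "W \<subseteq> K (Suc n)"
    using assms(1) unfolding compact_exhaustion_def by metis
  have "U \<inter> W \<subseteq> P (Suc n)" using U(3) W(3) by auto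
  then have "openin X (U \<inter> W)" "x \<in> U \<inter> W" "U \<inter> W \<subseteq> (\<Union>n. P n)"
    using n assms(2)[of n] U W by auto
  then show "\<exists>T. openin X T \<and> x \<in> T \<and> T \<subseteq> (\<Union>n. P n)" by blast
qed

lemma openin_Union_exhaustion:
  assumes "compact_exhaustion X K"
  shows "openin X (\<Union>n. K n)"
proof (rule openin_Union_exhausted[OF assms])
  fix n show "\<exists>U. openin X U \<and> K n \<subseteq> U \<and> U \<inter> K (Suc n) \<subseteq> K (Suc n)"
    using assms unfolding compact_exhaustion_def by blast
qed simp

lemma compact_exhaustion_subtopology:
  assumes "compact_exhaustion X K" "(\<Union>n. K n) \<subseteq> Y"
  shows "compact_exhaustion (subtopology X Y) K"
  unfolding compact_exhaustion_def
proof (intro allI conjI)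
  fix n
  have sub: "K m \<subseteq> Y" for m using assms(2) by auto
  then show "compactin (subtopology X Y) (K n)"
    using assms(1) by (simp add: compactin_subtopology compact_exhaustion_def)
  obtain U where "openin X U" "K n \<subseteq> U" "U \<subseteq> K (Suc n)"
    using assms(1) unfolding compact_exhaustion_def by metis
  then show "\<exists>U. openin (subtopology X Y) U \<and> K n \<subseteq> U \<and> U \<subseteq> K (Suc n)"
    using sub[of "Suc n"] by (intro exI[of _ U]) (auto simp: openin_subtopology intro!: exI[of _ U])
qed

section \<open>Separation in closed preorders\<close>

locale exhausted_preorder =
  fixes X :: "'a topology" and R :: "('a \<times> 'a) set" and K :: "nat \<Rightarrow> 'a set"
  assumes Hausdorff: "Hausdorff_space X"
    and exhaustion: "compact_exhaustion X K" "(\<Union>n. K n) = topspace X"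
    and closed: "closedin (prod_topology X X) R"
    and refl: "x \<in> topspace X \<Longrightarrow> (x, x) \<in> R"
    and trans: "(x, y) \<in> R \<Longrightarrow> (y, z) \<in> R \<Longrightarrow> (x, z) \<in> R"
begin

lemma in_topspace:
  assumes "(x, y) \<in> R"
  shows "x \<in> topspace X" "y \<in> topspace X"
  using assms closedin_subset[OF closed] by auto

lemma locally_compact: "locally_compact_space X"
  unfolding locally_compact_space_def
proof
  fix x assume "x \<in> topspace X"
  then obtain n where "x \<in> K n" using exhaustion(2) by auto
  then show "\<exists>U L. openin X U \<and> compactin X L \<and> x \<in> U \<and> U \<subseteq> L"
    using exhaustion(1) unfolding compact_exhaustion_def by (meson subsetD)
qed

definition down_closed where "down_closed A \<longleftrightarrow> (\<forall>(x, y) \<in> R. y \<in> A \<longrightarrow> x \<in> A)"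
definition up_closed where "up_closed A \<longleftrightarrow> (\<forall>(x, y) \<in> R. x \<in> A \<longrightarrow> y \<in> A)"

text \<open>\<open>P\<close> grows into a down-closed neighborhood of \<open>A\<close> and
  \<open>Q\<close> into an up-closed neighborhood of \<open>B\<close>. The condition on
  \<open>R\<close> forbids a point of \<open>Q\<close> below a point of \<open>P\<close>; with
  reflexivity it makes \<open>P\<close> and \<open>Q\<close> disjoint.\<close>

definition separated_pair where
  "separated_pair A B P Q \<longleftrightarrow> compactin X P \<and> compactin X Q \<and>
     R \<inter> Q \<times> P = {} \<and> P \<inter> B = {} \<and> Q \<inter> A = {}"

text \<open>The inductive step of Nachbin's separation. Compact neighborhoods \<open>C\<close> and
  \<open>D\<close> of the enlarged sets are chosen so that no point of \<open>D\<close> lies below a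
  point of \<open>C\<close>; the new pair consists of the parts in \<open>L\<close> of the
  down-closure of \<open>C\<close> and the up-closure of \<open>D\<close>.\<close>

lemma separated_pair_extend:
  assumes A: "closedin X A" "down_closed A" and B: "closedin X B" "up_closed B"
    and AB: "A \<inter> B = {}" and K: "compactin X L" and PQ: "separated_pair A B P Q"
  obtains P' Q' U V where "separated_pair A B P' Q'" "P' \<subseteq> L" "Q' \<subseteq> L"
    "openin X U" "P \<union> (A \<inter> L) \<subseteq> U" "U \<inter> L \<subseteq> P'"
    "openin X V" "Q \<union> (B \<inter> L) \<subseteq> V" "V \<inter> L \<subseteq> Q'"
    "\<And>x y. (x, y) \<in> R \<Longrightarrow> x \<in> L \<Longrightarrow> y \<in> P' \<Longrightarrow> x \<in> P'"
    "\<And>x y. (x, y) \<in> R \<Longrightarrow> y \<in> L \<Longrightarrow> x \<in> Q' \<Longrightarrow> y \<in> Q'"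
proof -
  have P: "compactin X (P \<union> (A \<inter> L))" and Q: "compactin X (Q \<union> (B \<inter> L))"
    using PQ K A B by (auto simp: separated_pair_def intro!: compactin_Un closed_Int_compactin)
  \<comment> \<open>A point below a point of \<open>A\<close> lies in \<open>A\<close>, and a point
    above a point of \<open>B\<close> lies in \<open>B\<close>. The disjointness conditions exclude
    both.\<close>
  have "R \<inter> (Q \<union> (B \<inter> L)) \<times> (P \<union> (A \<inter> L)) = {}"
    using PQ A(2) B(2) AB unfolding separated_pair_def down_closed_def up_closed_def by fast
  then have "(Q \<union> (B \<inter> L)) \<times> (P \<union> (A \<inter> L)) \<subseteq> topspace (prod_topology X X) - R"
    using compactin_subset_topspace[OF P] compactin_subset_topspace[OF Q] by auto
  moreover have "openin (prod_topology X X) (topspace (prod_topology X X) - R)"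
    using closed by blast
  ultimately obtain N2 N1 where N: "openin X N2" "openin X N1" "Q \<union> (B \<inter> L) \<subseteq> N2"
    "P \<union> (A \<inter> L) \<subseteq> N1" "N2 \<times> N1 \<subseteq> topspace (prod_topology X X) - R"
    using Wallace_theorem_prod_topology[OF Q P] by metis
  have "openin X (N1 - B)" "openin X (N2 - A)" using N A B by auto
  moreover have "P \<union> (A \<inter> L) \<subseteq> N1 - B" "Q \<union> (B \<inter> L) \<subseteq> N2 - A"
    using N PQ AB by (auto simp: separated_pair_def)
  ultimately obtain U C V D where
    U: "openin X U" "compactin X C" "P \<union> (A \<inter> L) \<subseteq> U" "U \<subseteq> C" "C \<subseteq> N1 - B" and
    V: "openin X V" "compactin X D" "Q \<union> (B \<inter> L) \<subseteq> V" "V \<subseteq> D" "D \<subseteq> N2 - A"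
    using compact_neighbourhood_within[OF locally_compact Hausdorff] P Q by metis
  have DC: "R \<inter> D \<times> C = {}" using U V N(5) by blast
  show thesis
  proof (rule that)
    have "compactin X (R `` D \<inter> L)" "compactin X (R\<inverse> `` C \<inter> L)"
      using compactin_closed_relation_image closed closedin_converse[OF closed] U V K by metis+
    \<comment> \<open>A related pair here would give a path in \<open>R\<close> from
      \<open>D\<close> to \<open>C\<close>, which transitivity shortens to a member of
      \<open>R \<inter> D \<times> C\<close>.\<close>
    moreover have "R \<inter> (R `` D \<inter> L) \<times> (R\<inverse> `` C \<inter> L) = {}"
      using DC by (blast dest: trans)
    moreover have "(R\<inverse> `` C \<inter> L) \<inter> B = {}" "(R `` D \<inter> L) \<inter> A = {}"
      using U(5) V(5) A(2) B(2) unfolding down_closed_def up_closed_def by fast+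
    ultimately show "separated_pair A B (R\<inverse> `` C \<inter> L) (R `` D \<inter> L)"
      by (simp add: separated_pair_def)
    show "U \<inter> L \<subseteq> R\<inverse> `` C \<inter> L" "V \<inter> L \<subseteq> R `` D \<inter> L"
      using U(4) V(4) openin_subset[OF U(1)] openin_subset[OF V(1)] by (blast intro: refl)+
    show "x \<in> R\<inverse> `` C \<inter> L" if xy: "(x, y) \<in> R" "x \<in> L" "y \<in> R\<inverse> `` C \<inter> L" for x y
    proof -
      obtain c where "c \<in> C" "(y, c) \<in> R" using xy(3) by auto
      with trans[OF xy(1)] xy(2) show ?thesis by auto
    qed
    show "y \<in> R `` D \<inter> L" if xy: "(x, y) \<in> R" "y \<in> L" "x \<in> R `` D \<inter> L" for x y
    proof -
      obtain c where "c \<in> D" "(c, x) \<in> R" using xy(3) by auto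
      with trans[OF _ xy(1)] xy(2) show ?thesis by auto
    qed
  qed (use U V in auto)
qed

text \<open>The neighborhoods are unions of compact stages. Stage \<open>n\<close> is closed
  downward or upward only within \<open>K n\<close>, but every point lies in all late
  \<open>K n\<close>, and this makes the unions down-closed and up-closed.\<close>

lemma separation:
  assumes A: "closedin X A" "down_closed A" and B: "closedin X B" "up_closed B" and AB: "A \<inter> B = {}"
  obtains U V where "openin X U" "down_closed U" "A \<subseteq> U" "openin X V" "up_closed V" "B \<subseteq> V"
    "U \<inter> V = {}"
proof -
  \<comment> \<open>\<open>?I n\<close> is the invariant of stage \<open>n\<close>.
    \<open>?N\<close> and \<open>?J\<close> say that the next stage contains a neighborhood,
    relative to \<open>K (Suc n)\<close>, of the old stage together with the parts of
    \<open>A\<close> and \<open>B\<close> in \<open>K (Suc n)\<close>.\<close>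
  let ?I = "\<lambda>n p. separated_pair A B (fst p) (snd p) \<and> fst p \<subseteq> K n \<and> snd p \<subseteq> K n \<and>
      (\<forall>x y. (x, y) \<in> R \<longrightarrow> x \<in> K n \<longrightarrow> y \<in> fst p \<longrightarrow> x \<in> fst p) \<and>
      (\<forall>x y. (x, y) \<in> R \<longrightarrow> y \<in> K n \<longrightarrow> x \<in> snd p \<longrightarrow> y \<in> snd p)"
  let ?N = "\<lambda>n S T S'. \<exists>U. openin X U \<and> S \<union> (T \<inter> K (Suc n)) \<subseteq> U \<and> U \<inter> K (Suc n) \<subseteq> S'"
  let ?J = "\<lambda>n p q. ?N n (fst p) A (fst q) \<and> ?N n (snd p) B (snd q)"
  have Kc: "compactin X (K n)" for n using exhaustion by (simp add: compact_exhaustion_def)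
  have "\<exists>f. \<forall>n. ?I n (f n) \<and> ?J n (f n) (f (Suc n))"
  proof (rule dependent_nat_choice)
    show "\<exists>p. ?I 0 p"
      by (rule exI[of _ "({}, {})"]) (simp add: separated_pair_def)
    fix p n assume "?I n p"
    then have "separated_pair A B (fst p) (snd p)" by blast
    then show "\<exists>q. ?I (Suc n) q \<and> ?J n p q"
    proof (rule separated_pair_extend[OF A B AB Kc[of "Suc n"]])
      fix P' Q' U V
      assume 1: "separated_pair A B P' Q'" "P' \<subseteq> K (Suc n)" "Q' \<subseteq> K (Suc n)"
        and 2: "openin X U" "fst p \<union> (A \<inter> K (Suc n)) \<subseteq> U" "U \<inter> K (Suc n) \<subseteq> P'"
        and 3: "openin X V" "snd p \<union> (B \<inter> K (Suc n)) \<subseteq> V" "V \<inter> K (Suc n) \<subseteq> Q'"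
        and 4: "\<And>x y. (x, y) \<in> R \<Longrightarrow> x \<in> K (Suc n) \<Longrightarrow> y \<in> P' \<Longrightarrow> x \<in> P'"
        and 5: "\<And>x y. (x, y) \<in> R \<Longrightarrow> y \<in> K (Suc n) \<Longrightarrow> x \<in> Q' \<Longrightarrow> y \<in> Q'"
      have "?I (Suc n) (P', Q')" unfolding fst_conv snd_conv using 1 4 5 by blast
      moreover have "?J n p (P', Q')" unfolding fst_conv snd_conv using 2 3 by blast
      ultimately show "\<exists>q. ?I (Suc n) q \<and> ?J n p q" by blast
    qed
  qed
  then obtain f where f: "\<forall>n. ?I n (f n) \<and> ?J n (f n) (f (Suc n))" ..
  define P where "P n = fst (f n)" for n
  define Q where "Q n = snd (f n)" for n
  have PK: "P n \<subseteq> K n" and QK: "Q n \<subseteq> K n" and PQ: "R \<inter> Q n \<times> P n = {}" for n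
    using spec[OF f, of n] by (simp_all add: P_def Q_def separated_pair_def)
  have Pdown: "(x, y) \<in> R \<Longrightarrow> x \<in> K n \<Longrightarrow> y \<in> P n \<Longrightarrow> x \<in> P n"
    and Qup: "(x, y) \<in> R \<Longrightarrow> y \<in> K n \<Longrightarrow> x \<in> Q n \<Longrightarrow> y \<in> Q n" for x y n
    using spec[OF f, THEN conjunct1, of n] unfolding P_def Q_def by blast+
  have PN: "?N n (P n) A (P (Suc n))" and QN: "?N n (Q n) B (Q (Suc n))" for n
    using spec[OF f, THEN conjunct2, of n] unfolding P_def Q_def by blast+
  have Kmono: "K m \<subseteq> K n" if "m \<le> n" for m n
    using compact_exhaustion_mono[OF exhaustion(1) that] .
  have inc: "P n \<subseteq> P (Suc n)" "Q n \<subseteq> Q (Suc n)" for n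
    using PN[of n] QN[of n] PK[of n] QK[of n] Kmono[of n "Suc n"] by (simp_all, blast+)
  have Pmono: "P m \<subseteq> P n" and Qmono: "Q m \<subseteq> Q n" if "m \<le> n" for m n
    using lift_Suc_mono_le[of P, OF inc(1) that] lift_Suc_mono_le[of Q, OF inc(2) that] .
  have ex: "\<exists>n\<ge>m. x \<in> K n" if x: "x \<in> topspace X" for x m
  proof -
    obtain n where "x \<in> K n" using x exhaustion(2) by auto
    then have "x \<in> K (max m n)" using Kmono[of n "max m n"] by auto
    then show ?thesis by (meson max.cobounded1)
  qed
  show thesis
  proof (rule that)
    have "\<exists>U. openin X U \<and> P n \<subseteq> U \<and> U \<inter> K (Suc n) \<subseteq> P (Suc n)" for n
      using PN[of n] unfolding Un_subset_iff by blast
    then show "openin X (\<Union>n. P n)"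
      by (rule openin_Union_exhausted[OF exhaustion(1) PK])
    have "\<exists>U. openin X U \<and> Q n \<subseteq> U \<and> U \<inter> K (Suc n) \<subseteq> Q (Suc n)" for n
      using QN[of n] unfolding Un_subset_iff by blast
    then show "openin X (\<Union>n. Q n)"
      by (rule openin_Union_exhausted[OF exhaustion(1) QK])
    show "down_closed (\<Union>n. P n)"
      unfolding down_closed_def
    proof clarify
      fix x y n assume xy: "(x, y) \<in> R" "y \<in> P n"
      obtain m where "m \<ge> n" "x \<in> K m" using ex in_topspace(1)[OF xy(1)] by blast
      then have "x \<in> P m" using Pdown[OF xy(1)] subsetD[OF Pmono xy(2)] by simp
      then show "x \<in> (\<Union>n. P n)" by blast
    qed
    show "up_closed (\<Union>n. Q n)"
      unfolding up_closed_def
    proof clarify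
      fix x y n assume xy: "(x, y) \<in> R" "x \<in> Q n"
      obtain m where "m \<ge> n" "y \<in> K m" using ex in_topspace(2)[OF xy(1)] by blast
      then have "y \<in> Q m" using Qup[OF xy(1)] subsetD[OF Qmono xy(2)] by simp
      then show "y \<in> (\<Union>n. Q n)" by blast
    qed
    show "A \<subseteq> (\<Union>n. P n)"
    proof
      fix x assume x: "x \<in> A"
      then have "x \<in> topspace X" using closedin_subset[OF A(1)] by auto
      \<comment> \<open>The pair may be empty at stage 0, and points of \<open>A\<close> enter only
        at successor stages, so an index of the form \<open>Suc k\<close> is needed.\<close>
      from ex[OF this, of "Suc 0"] obtain k where "x \<in> K (Suc k)" by (metis Suc_le_D)
      then have "x \<in> P (Suc k)" using PN[of k] x by auto
      then show "x \<in> (\<Union>n. P n)" by blast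
    qed
    show "B \<subseteq> (\<Union>n. Q n)"
    proof
      fix x assume x: "x \<in> B"
      then have "x \<in> topspace X" using closedin_subset[OF B(1)] by auto
      from ex[OF this, of "Suc 0"] obtain k where "x \<in> K (Suc k)" by (metis Suc_le_D)
      then have "x \<in> Q (Suc k)" using QN[of k] x by auto
      then show "x \<in> (\<Union>n. Q n)" by blast
    qed
    show "(\<Union>n. P n) \<inter> (\<Union>n. Q n) = {}"
    proof (rule ccontr)
      assume "(\<Union>n. P n) \<inter> (\<Union>n. Q n) \<noteq> {}"
      then obtain x m n where "x \<in> P m" "x \<in> Q n" by blast
      then have x: "x \<in> P (max m n)" "x \<in> Q (max m n)"
        using Pmono[of m "max m n"] Qmono[of n "max m n"] by auto
      then have "x \<in> topspace X" using PK[of "max m n"] compactin_subset_topspace[OF Kc, of "max m n"] by auto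
      then have "(x, x) \<in> R \<inter> Q (max m n) \<times> P (max m n)" using refl x by simp
      then show False using PQ by simp
    qed
  qed
qed

section \<open>Interpolation and monotone Urysohn functions\<close>

definition well_inside where
  "well_inside S T \<longleftrightarrow> (\<exists>C V. closedin X C \<and> down_closed C \<and> openin X V \<and> down_closed V \<and>
     S \<subseteq> C \<and> C \<subseteq> V \<and> V \<subseteq> T)"

lemma well_inside_trans: "well_inside S T \<Longrightarrow> well_inside T U \<Longrightarrow> well_inside S U"
  unfolding well_inside_def by (meson subset_trans)

lemma well_inside_dense:
  assumes "well_inside S T"
  shows "\<exists>Z. well_inside S Z \<and> well_inside Z T"
proof -
  obtain C V where CV: "closedin X C" "down_closed C" "openin X V" "down_closed V" "S \<subseteq> C" "C \<subseteq> V" "V \<subseteq> T"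
    using assms unfolding well_inside_def by blast
  have "up_closed (topspace X - V)"
    using CV(4) in_topspace by (auto simp: up_closed_def down_closed_def)
  moreover have "closedin X (topspace X - V)" "C \<inter> (topspace X - V) = {}" using CV by auto
  ultimately obtain U W where UW: "openin X U" "down_closed U" "C \<subseteq> U" "openin X W" "up_closed W"
    "topspace X - V \<subseteq> W" "U \<inter> W = {}"
    using separation[OF CV(1,2)] by metis
  have "down_closed (topspace X - W)"
    using UW(5) in_topspace by (auto simp: up_closed_def down_closed_def)
  moreover have "closedin X (topspace X - W)" "U \<subseteq> topspace X - W" "topspace X - W \<subseteq> V"
    using UW openin_subset[OF UW(1)] by auto
  ultimately have "well_inside U T" "well_inside S U"
    using CV UW unfolding well_inside_def by blast+
  then show ?thesis by blast
qed

lemma Urysohn_monotone: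
  assumes A: "closedin X A" "down_closed A" and B: "closedin X B" "up_closed B" and AB: "A \<inter> B = {}"
  obtains L :: "'a \<Rightarrow> real" where "continuous_map X euclideanreal L" "\<And>x. 0 \<le> L x" "\<And>x. L x \<le> 1"
    "\<And>x y. (x, y) \<in> R \<Longrightarrow> L x \<le> L y" "\<And>x. x \<in> A \<Longrightarrow> L x = 0" "\<And>x. x \<in> B \<Longrightarrow> L x = 1"
proof -
  have "down_closed (topspace X - B)"
    using B in_topspace by (auto simp: up_closed_def down_closed_def)
  then have base: "well_inside A (topspace X - B)"
    unfolding well_inside_def using A B AB closedin_subset[OF A(1)]
    by (intro exI[of _ A] exI[of _ "topspace X - B"]) auto
  define D where "D = dyadics \<inter> {0..1::real}"
  have "\<exists>G. G 0 = A \<and> G 1 = topspace X - B \<and> (\<forall>r\<in>D. \<forall>s\<in>D. r < s \<longrightarrow> well_inside (G r) (G s))"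
    unfolding D_def by (rule recursion_on_dyadic_fractions[OF base well_inside_dense well_inside_trans])
  then obtain G where G01: "G 0 = A" "G 1 = topspace X - B"
    and G: "\<And>r s. r \<in> D \<Longrightarrow> s \<in> D \<Longrightarrow> r < s \<Longrightarrow> well_inside (G r) (G s)"
    by blast
  have D01: "0 \<in> D" "1 \<in> D" by (force simp: D_def dyadics_def)+
  have Dle: "0 \<le> r" "r \<le> 1" if "r \<in> D" for r using that by (auto simp: D_def)
  have dense: "\<exists>r\<in>D. a < r \<and> r < b" if ab: "0 \<le> a" "a < b" "b \<le> 1" for a b :: real
  proof (rule padic_rational_approximation_straddle_pos_le[of "b - a" 2 a])
    fix n q r
    assume "of_nat q / 2^n \<le> a" "a < of_nat r / 2^n" "\<bar>of_nat q / 2^n - of_nat r / 2^n\<bar> < b - a"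
    then have r: "a < real r / 2^n" "real r / 2^n < b" by auto
    have "real r / 2^n \<in> dyadics" by (auto simp: dyadics_def)
    moreover have "real r / 2^n \<in> {0..1}" using r ab unfolding atLeastAtMost_iff by linarith
    ultimately show ?thesis using r unfolding D_def by blast
  qed (use ab in auto)
  have Gmono: "G r \<subseteq> G s" if "r \<in> D" "s \<in> D" "r \<le> s" for r s
    using G[of r s] that by (cases "r = s") (auto simp: well_inside_def)
  define L where "L x = Inf (insert 1 {r \<in> D. x \<in> G r})" for x
  have bdd: "bdd_below (insert 1 {r \<in> D. x \<in> G r})" for x
    using Dle by (auto intro!: bdd_belowI[of _ 0])
  have L0: "0 \<le> L x" for x
    unfolding L_def using Dle(1) by (intro cInf_greatest) auto
  have L1: "L x \<le> 1" for x
    unfolding L_def using bdd by (intro cInf_lower) auto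
  have Lle: "L x \<le> r" if "r \<in> D" "x \<in> G r" for x r
    unfolding L_def using that bdd by (intro cInf_lower) auto
  have Lge: "r \<le> L x" if r: "r \<in> D" "x \<notin> G r" for x r
    unfolding L_def
  proof (rule cInf_greatest)
    fix s assume "s \<in> insert 1 {r \<in> D. x \<in> G r}"
    then show "r \<le> s" using r Dle[OF r(1)] Gmono[of s r] by (cases "s \<le> r") auto
  qed simp
  have Lless: "\<exists>r\<in>D. x \<in> G r \<and> r < a" if "L x < a" "a \<le> 1" for x a
    using cInf_lessD[of "insert 1 {r \<in> D. x \<in> G r}" a] that unfolding L_def by auto
  have "continuous_map X euclideanreal L"
    unfolding continuous_map_upper_lower_semicontinuous_lt
  proof (intro conjI allI)
    fix a
    show "openin X {x \<in> topspace X. a < L x}"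
    proof (cases "a < 0")
      case True
      then have "{x \<in> topspace X. a < L x} = topspace X" using L0 by (auto intro: less_le_trans)
      then show ?thesis by simp
    next
      case False
      show ?thesis
      proof (subst openin_subopen, intro ballI)
        fix x assume "x \<in> {x \<in> topspace X. a < L x}"
        then have x: "x \<in> topspace X" "a < L x" by auto
        obtain s where s: "s \<in> D" "a < s" "s < L x" using dense[of a "L x"] x False L1 by auto
        obtain r where r: "r \<in> D" "a < r" "r < s" using dense[of a s] s False Dle by auto
        obtain C where C: "closedin X C" "G r \<subseteq> C" "C \<subseteq> G s"
          using G[of r s] r s unfolding well_inside_def by blast
        have "x \<notin> G s" using Lle s by force
        moreover have "a < L y" if "y \<notin> C" for y
          using Lge[of r y] subsetD[OF C(2), of y] that r by (meson less_le_trans)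
        ultimately show "\<exists>T. openin X T \<and> x \<in> T \<and> T \<subseteq> {x \<in> topspace X. a < L x}"
          using C x by (intro exI[of _ "topspace X - C"]) auto
      qed
    qed
    show "openin X {x \<in> topspace X. L x < a}"
    proof (cases "1 < a")
      case True
      then have "{x \<in> topspace X. L x < a} = topspace X" using L1 by (auto intro: le_less_trans)
      then show ?thesis by simp
    next
      case False
      show ?thesis
      proof (subst openin_subopen, intro ballI)
        fix x assume "x \<in> {x \<in> topspace X. L x < a}"
        then obtain r where r: "r \<in> D" "x \<in> G r" "r < a" using Lless False by force
        then obtain s where s: "s \<in> D" "r < s" "s < a" using dense[of r a] False Dle by auto
        obtain V where V: "openin X V" "G r \<subseteq> V" "V \<subseteq> G s"
          using G[of r s] r s unfolding well_inside_def by blast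
        have "L y < a" if "y \<in> V" for y
          using Lle[of s y] V that s by auto
        then show "\<exists>T. openin X T \<and> x \<in> T \<and> T \<subseteq> {x \<in> topspace X. L x < a}"
          using V r openin_subset[OF V(1)] by (intro exI[of _ V]) auto
      qed
    qed
  qed
  moreover have "L x \<le> L y" if xy: "(x, y) \<in> R" for x y
  proof (rule ccontr)
    assume "\<not> L x \<le> L y"
    then obtain r where r: "r \<in> D" "y \<in> G r" "r < L x" using Lless[of y "L x"] L1 by auto
    then obtain s where s: "s \<in> D" "r < s" "s < L x" using dense[of r "L x"] L1 Dle by auto
    obtain C where "down_closed C" "G r \<subseteq> C" "C \<subseteq> G s"
      using G[of r s] r s unfolding well_inside_def by blast
    then have "x \<in> G s" using xy r unfolding down_closed_def by blast
    then show False using Lle[of s x] s by simp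
  qed
  moreover have "L x = 0" if "x \<in> A" for x
    using Lle[of 0 x] L0[of x] G01 D01 that by simp
  moreover have "L x = 1" if "x \<in> B" for x
    using Lge[of 1 x] L1[of x] G01 D01 that by simp
  ultimately show thesis using that L0 L1 by blast
qed

lemma monotone_function_separating:
  assumes P: "compactin X P" and y: "y \<in> topspace X" and "\<And>p. p \<in> P \<Longrightarrow> (p, y) \<notin> R"
  obtains L :: "'a \<Rightarrow> real" where "continuous_map X euclideanreal L" "\<And>x. 0 \<le> L x" "\<And>x. L x \<le> 1"
    "\<And>x y. (x, y) \<in> R \<Longrightarrow> L x \<le> L y" "L y = 0" "\<And>x. x \<in> P \<Longrightarrow> L x = 1"
proof -
  have "compactin X {y}" using y by simp
  then have closed_images: "closedin X (R\<inverse> `` {y})" "closedin X (R `` P)"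
    using closedin_relation_image_compact closed closedin_converse[OF closed] P by metis+
  have down: "down_closed (R\<inverse> `` {y})"
    unfolding down_closed_def using trans by blast
  have up: "up_closed (R `` P)"
    unfolding up_closed_def using trans by blast
  have disjoint: "R\<inverse> `` {y} \<inter> R `` P = {}" using trans assms(3) by blast
  show thesis
  proof (rule Urysohn_monotone[OF closed_images(1) down closed_images(2) up disjoint])
    fix L :: "'a \<Rightarrow> real"
    assume L: "continuous_map X euclideanreal L" "\<And>x. 0 \<le> L x" "\<And>x. L x \<le> 1"
      "\<And>x y. (x, y) \<in> R \<Longrightarrow> L x \<le> L y"
      and L01: "\<And>x. x \<in> R\<inverse> `` {y} \<Longrightarrow> L x = 0" "\<And>x. x \<in> R `` P \<Longrightarrow> L x = 1"
    have "y \<in> R\<inverse> `` {y}" using refl[OF y] by blast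
    moreover have "x \<in> R `` P" if "x \<in> P" for x
      using refl[of x] that compactin_subset_topspace[OF P] by blast
    ultimately show thesis using that[OF L] L01 by blast
  qed
qed

end

section \<open>Gages and chains\<close>

lemma gage_diagonal_nbhds_iff:
  "d \<in> gage (topspace X) (diagonal_nbhds X) \<longleftrightarrow>
     pseudo_metric_on (topspace X) d \<and> (\<exists>B. \<forall>x\<in>topspace X. \<forall>y\<in>topspace X. d x y \<le> B) \<and>
     (\<forall>x\<in>topspace X. \<forall>e>0. \<exists>U. openin X U \<and> x \<in> U \<and> (\<forall>y\<in>U. d x y < e))"
  (is "?l \<longleftrightarrow> ?pm \<and> ?bdd \<and> ?balls")
proof -
  have "?balls" if "?l"
  proof (intro ballI allI impI)
    fix x and e :: real assume x: "x \<in> topspace X" and "e > 0"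
    with that have "{(x, y). x \<in> topspace X \<and> y \<in> topspace X \<and> d x y < e} \<in> diagonal_nbhds X"
      by (simp add: gage_def)
    then obtain W where W: "openin (prod_topology X X) W" "Id_on (topspace X) \<subseteq> W"
      "W \<subseteq> {(x, y). x \<in> topspace X \<and> y \<in> topspace X \<and> d x y < e}"
      by (auto simp: diagonal_nbhds_def)
    then have "(x, x) \<in> W" using x by auto
    then obtain U V where "openin X U" "openin X V" "x \<in> U" "x \<in> V" "U \<times> V \<subseteq> W"
      using W(1) unfolding openin_prod_topology_alt by meson
    then show "\<exists>U. openin X U \<and> x \<in> U \<and> (\<forall>y\<in>U. d x y < e)"
      using W(3) by (intro exI[of _ V]) blast
  qed
  moreover have "{(x, y). x \<in> topspace X \<and> y \<in> topspace X \<and> d x y < e} \<in> diagonal_nbhds X"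
    if pm: ?pm and balls: ?balls and e: "e > 0" for e
  proof -
    let ?D = "{(x, y). x \<in> topspace X \<and> y \<in> topspace X \<and> d x y < e}"
    have "\<exists>U. openin X U \<and> x \<in> U \<and> U \<times> U \<subseteq> ?D" if x: "x \<in> topspace X" for x
    proof -
      obtain U where U: "openin X U" "x \<in> U" "\<forall>y\<in>U. d x y < e / 2"
        using balls x half_gt_zero[OF e] by meson
      have "U \<times> U \<subseteq> ?D"
      proof clarify
        fix y z assume yz: "y \<in> U" "z \<in> U"
        then have yzX: "y \<in> topspace X" "z \<in> topspace X" using openin_subset[OF U(1)] by auto
        then have "d y z \<le> d x y + d x z"
          using pm x unfolding pseudo_metric_on_def by metis
        moreover have "d x y < e / 2" "d x z < e / 2" using U(3) yz by auto
        ultimately show "y \<in> topspace X \<and> z \<in> topspace X \<and> d y z < e" using yzX by simp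
      qed
      then show ?thesis using U by blast
    qed
    note nbhd = this
    let ?W = "\<Union>{U \<times> U |U. openin X U \<and> U \<times> U \<subseteq> ?D}"
    have "openin (prod_topology X X) ?W"
      by (intro openin_Union) (auto simp: openin_prod_Times_iff)
    moreover have "Id_on (topspace X) \<subseteq> ?W"
    proof
      fix p assume "p \<in> Id_on (topspace X)"
      then obtain x where x: "x \<in> topspace X" "p = (x, x)" by auto
      obtain U where "openin X U" "x \<in> U" "U \<times> U \<subseteq> ?D" using nbhd[OF x(1)] by blast
      then have "p \<in> U \<times> U" "U \<times> U \<in> {U \<times> U |U. openin X U \<and> U \<times> U \<subseteq> ?D}"
        using x(2) by blast+
      then show "p \<in> ?W" by (rule UnionI[rotated])
    qed
    moreover have "?W \<subseteq> ?D" by (intro Union_least) (clarify, blast)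
    moreover have "?D \<subseteq> topspace X \<times> topspace X" by auto
    ultimately show ?thesis unfolding diagonal_nbhds_def by blast
  qed
  ultimately show ?thesis by (auto simp: gage_def)
qed

lemma gage_abs_diff:
  fixes L :: "'a \<Rightarrow> real"
  assumes L: "continuous_map X euclideanreal L" "\<And>x. x \<in> topspace X \<Longrightarrow> \<bar>L x\<bar> \<le> B"
  shows "(\<lambda>x y. \<bar>L x - L y\<bar>) \<in> gage (topspace X) (diagonal_nbhds X)"
  unfolding gage_diagonal_nbhds_iff
proof (intro conjI ballI allI impI)
  show "pseudo_metric_on (topspace X) (\<lambda>x y. \<bar>L x - L y\<bar>)"
    by (auto simp: pseudo_metric_on_def)
  show "\<exists>B. \<forall>x\<in>topspace X. \<forall>y\<in>topspace X. \<bar>L x - L y\<bar> \<le> B"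
  proof (intro exI ballI)
    fix x y assume "x \<in> topspace X" "y \<in> topspace X"
    then show "\<bar>L x - L y\<bar> \<le> B + B" using L(2)[of x] L(2)[of y] by linarith
  qed
  fix x and e :: real assume "x \<in> topspace X" "e > 0"
  moreover have "openin X {y \<in> topspace X. L y \<in> {L x - e<..<L x + e}}"
    by (intro openin_continuous_map_preimage[OF L(1)]) auto
  ultimately show "\<exists>U. openin X U \<and> x \<in> U \<and> (\<forall>y\<in>U. \<bar>L x - L y\<bar> < e)"
    by (intro exI[of _ "{y \<in> topspace X. L y \<in> {L x - e<..<L x + e}}"]) auto
qed

lemma gage_add:
  assumes d: "d \<in> gage (topspace X) (diagonal_nbhds X)" and d': "d' \<in> gage (topspace X) (diagonal_nbhds X)"
  shows "(\<lambda>x y. d x y + d' x y) \<in> gage (topspace X) (diagonal_nbhds X)"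
  unfolding gage_diagonal_nbhds_iff
proof (intro conjI ballI allI impI)
  have pm: "pseudo_metric_on (topspace X) d" "pseudo_metric_on (topspace X) d'"
    and bdd: "\<exists>B. \<forall>x\<in>topspace X. \<forall>y\<in>topspace X. d x y \<le> B" "\<exists>B. \<forall>x\<in>topspace X. \<forall>y\<in>topspace X. d' x y \<le> B"
    using d d' by (simp_all add: gage_def)
  show "pseudo_metric_on (topspace X) (\<lambda>x y. d x y + d' x y)"
    unfolding pseudo_metric_on_def
  proof (intro conjI ballI)
    fix x y z assume "x \<in> topspace X" "y \<in> topspace X" "z \<in> topspace X"
    then have "d x z \<le> d x y + d y z" "d' x z \<le> d' x y + d' y z"
      using pm by (simp_all add: pseudo_metric_on_def)
    then show "d x z + d' x z \<le> d x y + d' x y + (d y z + d' y z)" by simp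
  qed (use pm in \<open>simp_all add: pseudo_metric_on_def\<close>)
  obtain B where B: "\<forall>x\<in>topspace X. \<forall>y\<in>topspace X. d x y \<le> B" using bdd(1) ..
  obtain B' where B': "\<forall>x\<in>topspace X. \<forall>y\<in>topspace X. d' x y \<le> B'" using bdd(2) ..
  show "\<exists>B. \<forall>x\<in>topspace X. \<forall>y\<in>topspace X. d x y + d' x y \<le> B"
    using B B' by (intro exI[of _ "B + B'"]) (simp add: add_mono)
  fix x and e :: real assume x: "x \<in> topspace X" "e > 0"
  then have e: "e / 2 > 0" by simp
  obtain U where U: "openin X U" "x \<in> U" "\<forall>y\<in>U. d x y < e / 2"
    using d e x(1) unfolding gage_diagonal_nbhds_iff by blast
  obtain V where V: "openin X V" "x \<in> V" "\<forall>y\<in>V. d' x y < e / 2"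
    using d' e x(1) unfolding gage_diagonal_nbhds_iff by blast
  have "d x y + d' x y < e" if "y \<in> U \<inter> V" for y
    using U(3) V(3) that by (auto dest!: bspec)
  then show "\<exists>U. openin X U \<and> x \<in> U \<and> (\<forall>y\<in>U. d x y + d' x y < e)"
    using U V by (intro exI[of _ "U \<inter> V"]) auto
qed

definition chain_cost :: "('a \<Rightarrow> 'a \<Rightarrow> real) \<Rightarrow> 'a \<Rightarrow> 'a \<Rightarrow> nat \<Rightarrow> (nat \<Rightarrow> 'a) \<Rightarrow> (nat \<Rightarrow> 'a) \<Rightarrow> real" where
  "chain_cost d x y n a b = d x (a 1) + (\<Sum>i = 1..<n. d (b i) (a (i + 1))) + d (b n) y"

definition chain_below :: "('a \<times> 'a) set \<Rightarrow> ('a \<Rightarrow> 'a \<Rightarrow> real) \<Rightarrow> real \<Rightarrow> 'a \<Rightarrow> 'a \<Rightarrow> bool" where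
  "chain_below f d e x y \<longleftrightarrow> (\<exists>n\<ge>1. \<exists>a b :: nat \<Rightarrow> 'a. (\<forall>i\<in>{1..n}. (a i, b i) \<in> f) \<and> chain_cost d x y n a b < e)"

lemma chain_relation_eq:
  "chain_relation S \<U> f = {(x, y). x \<in> S \<and> y \<in> S \<and> (\<forall>d\<in>gage S \<U>. \<forall>e>0. chain_below f d e x y)}"
  by (simp add: chain_relation_def chain_below_def chain_cost_def)

lemma chain_cost_Suc:
  assumes "n \<ge> 1"
  shows "chain_cost d x y (Suc n) a b = d x (a 1) + chain_cost d (b 1) y n (\<lambda>i. a (Suc i)) (\<lambda>i. b (Suc i))"
proof -
  have "(\<Sum>i = 1..<Suc n. d (b i) (a (i + 1))) = d (b 1) (a 2) + (\<Sum>i = Suc 1..<Suc n. d (b i) (a (i + 1)))"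
    using assms by (subst sum.atLeast_Suc_lessThan) (auto simp: numeral_2_eq_2)
  then show ?thesis unfolding chain_cost_def sum.shift_bounds_Suc_ivl by (simp add: numeral_2_eq_2)
qed

lemma chain_below_single:
  assumes "(a, b) \<in> f" "d x a + d b y < e"
  shows "chain_below f d e x y"
  unfolding chain_below_def chain_cost_def using assms
  by (intro exI[of _ 1] conjI exI[of _ "\<lambda>_. a"] exI[of _ "\<lambda>_. b"]) auto

lemma chain_below_Cons:
  assumes f0: "(a0, b0) \<in> f" and "chain_below f d (e - d x a0) b0 y"
  shows "chain_below f d e x y"
proof -
  obtain n a b where n: "n \<ge> 1" and f: "\<forall>i\<in>{1..n}. (a i, b i) \<in> f"
    and e: "chain_cost d b0 y n a b < e - d x a0"
    using assms(2) by (auto simp: chain_below_def)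
  define a' where "a' i = (if i = 1 then a0 else a (i - 1))" for i
  define b' where "b' i = (if i = 1 then b0 else b (i - 1))" for i
  have "chain_cost d b0 y n (\<lambda>i. a' (Suc i)) (\<lambda>i. b' (Suc i)) = chain_cost d b0 y n a b"
    unfolding chain_cost_def a'_def b'_def using n by (auto intro!: sum.cong)
  then have "chain_cost d x y (Suc n) a' b' < e"
    using chain_cost_Suc[OF n, of d x y a' b'] e by (simp add: a'_def b'_def)
  moreover have "(a' i, b' i) \<in> f" if "i \<in> {1..Suc n}" for i
    using f f0 that by (cases i) (auto simp: a'_def b'_def Suc_le_eq)
  ultimately show ?thesis unfolding chain_below_def
    by (intro exI[of _ "Suc n"] conjI exI[of _ a'] exI[of _ b']) auto
qed

lemma chain_below_induct [consumes 1, case_names single Cons]: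
  assumes "chain_below f d e x y"
    and single: "\<And>a b e x. (a, b) \<in> f \<Longrightarrow> d x a + d b y < e \<Longrightarrow> P e x"
    and Cons: "\<And>a b e x. (a, b) \<in> f \<Longrightarrow> chain_below f d (e - d x a) b y \<Longrightarrow> P (e - d x a) b \<Longrightarrow> P e x"
  shows "P e x"
proof -
  obtain n a b where "n \<ge> 1" "\<forall>i\<in>{1..n}. (a i, b i) \<in> f" "chain_cost d x y n a b < e"
    using assms(1) by (auto simp: chain_below_def)
  then show ?thesis
  proof (induction n arbitrary: a b e x rule: nat_induct_at_least)
    case base
    then show ?case by (intro single[of "a 1" "b 1"]) (auto simp: chain_cost_def)
  next
    case (Suc n)
    let ?a = "\<lambda>i. a (Suc i)" and ?b = "\<lambda>i. b (Suc i)"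
    have f: "\<forall>i\<in>{1..n}. (?a i, ?b i) \<in> f" "(a 1, b 1) \<in> f" using Suc.prems(1) by auto
    have c: "chain_cost d (b 1) y n ?a ?b < e - d x (a 1)"
      using Suc.prems(2) chain_cost_Suc[OF Suc.hyps, of d x y a b] by simp
    have "chain_below f d (e - d x (a 1)) (b 1) y"
      unfolding chain_below_def using f(1) c Suc.hyps
      by (intro exI[of _ n] conjI exI[of _ ?a] exI[of _ ?b])
    from Cons[OF f(2) this Suc.IH[OF f(1) c]] show ?case .
  qed
qed

lemma chain_below_mono:
  assumes "chain_below f d e x y" "e \<le> e'"
  shows "chain_below f d e' x y"
  using assms less_le_trans unfolding chain_below_def by blast

context
  fixes S d f
  assumes d: "pseudo_metric_on S d" and f: "f \<subseteq> S \<times> S"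
begin

lemma pseudo_metric_triangle: "x \<in> S \<Longrightarrow> y \<in> S \<Longrightarrow> z \<in> S \<Longrightarrow> d x z \<le> d x y + d y z"
  using d by (auto simp: pseudo_metric_on_def)

lemma chain_below_shift_start:
  assumes "chain_below f d e x y" "x \<in> S" "x' \<in> S"
  shows "chain_below f d (e + d x' x) x' y"
  using assms(1,2)
proof (induction rule: chain_below_induct)
  case (single a b e x)
  then show ?case
    using pseudo_metric_triangle[of x' x a] assms(3) f by (intro chain_below_single[of a b]) auto
next
  case (Cons a b e x)
  then have "e - d x a \<le> e + d x' x - d x' a" using pseudo_metric_triangle[of x' x a] assms(3) f by auto
  from chain_below_mono[OF Cons.hyps(2) this] show ?case by (rule chain_below_Cons[OF Cons.hyps(1)])
qed

lemma chain_below_shift_end: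
  assumes "chain_below f d e x y" "y \<in> S" "y' \<in> S"
  shows "chain_below f d (e + d y y') x y'"
  using assms(1)
proof (induction rule: chain_below_induct)
  case (single a b e x)
  then show ?case
    using pseudo_metric_triangle[of b y y'] assms f by (intro chain_below_single[of a b]) auto
next
  case (Cons a b e x)
  show ?case
    by (rule chain_below_Cons[OF Cons.hyps(1)]) (use Cons.IH in \<open>simp add: algebra_simps\<close>)
qed

lemma chain_below_trans:
  assumes "chain_below f d e x y" "chain_below f d e' y z" "y \<in> S"
  shows "chain_below f d (e + e') x z"
  using assms(1)
proof (induction rule: chain_below_induct)
  case (single a b e x)
  then have "chain_below f d (e' + d b y) b z"
    using chain_below_shift_start[OF assms(2,3)] f by auto
  from chain_below_mono[OF this] single have "chain_below f d (e + e' - d x a) b z" by simp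
  then show ?case by (rule chain_below_Cons[OF single(1)])
next
  case (Cons a b e x)
  show ?case
    by (rule chain_below_Cons[OF Cons.hyps(1)]) (use Cons.IH in \<open>simp add: algebra_simps\<close>)
qed

end

lemma chain_relation_superset:
  assumes "f \<subseteq> S \<times> S"
  shows "f \<subseteq> chain_relation S \<U> f"
proof (rule subrelI)
  fix x y assume xy: "(x, y) \<in> f"
  then have S: "x \<in> S" "y \<in> S" using assms by auto
  have "chain_below f d e x y" if "d \<in> gage S \<U>" "e > 0" for d e
    using that S by (intro chain_below_single[OF xy]) (auto simp: gage_def pseudo_metric_on_def)
  then show "(x, y) \<in> chain_relation S \<U> f" using S by (simp add: chain_relation_eq)
qed

lemma trans_chain_relation:
  assumes f: "f \<subseteq> S \<times> S"
  shows "trans (chain_relation S \<U> f)"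
proof (rule transI)
  fix x y z assume xy: "(x, y) \<in> chain_relation S \<U> f" and yz: "(y, z) \<in> chain_relation S \<U> f"
  have "chain_below f d e x z" if d: "d \<in> gage S \<U>" and e: "e > 0" for d e
  proof -
    have "chain_below f d (e / 2) x y" "chain_below f d (e / 2) y z" "y \<in> S"
      using xy yz d e by (auto simp: chain_relation_eq)
    moreover have "pseudo_metric_on S d" using d by (simp add: gage_def)
    ultimately show ?thesis using chain_below_trans[OF _ f, of d "e / 2" x y "e / 2" z] by simp
  qed
  then show "(x, z) \<in> chain_relation S \<U> f" using xy yz by (simp add: chain_relation_eq)
qed

lemma closedin_chain_relation:
  assumes f: "f \<subseteq> topspace X \<times> topspace X"
  shows "closedin (prod_topology X X) (chain_relation (topspace X) (diagonal_nbhds X) f)"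
proof -
  let ?A = "chain_relation (topspace X) (diagonal_nbhds X) f"
  have "\<exists>T. openin (prod_topology X X) T \<and> p \<in> T \<and> T \<subseteq> topspace X \<times> topspace X - ?A"
    if p: "p \<in> topspace X \<times> topspace X - ?A" for p
  proof -
    obtain x y where xy: "p = (x, y)" "x \<in> topspace X" "y \<in> topspace X" "(x, y) \<notin> ?A" using p by auto
    then obtain d e where d: "d \<in> gage (topspace X) (diagonal_nbhds X)" and e: "e > 0"
      and no: "\<not> chain_below f d e x y"
      by (auto simp: chain_relation_eq)
    note d' = d[unfolded gage_diagonal_nbhds_iff]
    then have pm: "pseudo_metric_on (topspace X) d" by blast
    have e3: "e / 3 > 0" using e by simp
    obtain U where U: "openin X U" "x \<in> U" "\<forall>z\<in>U. d x z < e / 3" using d' e3 xy(2) by meson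
    obtain V where V: "openin X V" "y \<in> V" "\<forall>z\<in>V. d y z < e / 3" using d' e3 xy(3) by meson
    have "(x', y') \<notin> ?A" if x': "x' \<in> U" and y': "y' \<in> V" for x' y'
    proof
      assume "(x', y') \<in> ?A"
      then have c: "chain_below f d (e / 3) x' y'" and S: "x' \<in> topspace X" "y' \<in> topspace X"
        using d e3 by (auto simp: chain_relation_eq)
      have "chain_below f d (e / 3 + d x x') x y'"
        using chain_below_shift_start[OF pm f c S(1) xy(2)] .
      from chain_below_shift_end[OF pm f this S(2) xy(3)]
      have "chain_below f d (e / 3 + d x x' + d y' y) x y" .
      moreover have "d x x' < e / 3" "d y' y < e / 3"
        using U(3) V(3) x' y' pm S xy(3) by (auto simp: pseudo_metric_on_def)
      ultimately show False using no chain_below_mono by fastforce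
    qed
    then have "U \<times> V \<subseteq> topspace X \<times> topspace X - ?A"
      using openin_subset[OF U(1)] openin_subset[OF V(1)] by auto
    moreover have "openin (prod_topology X X) (U \<times> V)" using U V by (simp add: openin_prod_Times_iff)
    ultimately show ?thesis using U V xy(1) by blast
  qed
  then have "openin (prod_topology X X) (topspace X \<times> topspace X - ?A)"
    by (subst openin_subopen) blast
  moreover have "?A \<subseteq> topspace X \<times> topspace X" by (auto simp: chain_relation_def)
  ultimately show ?thesis by (simp add: closedin_def)
qed

lemma closed_trancl_subset_chain_relation:
  assumes "f \<subseteq> topspace X \<times> topspace X"
  shows "closed_trancl X f \<subseteq> chain_relation (topspace X) (diagonal_nbhds X) f"
  by (rule closed_trancl_least(4)[OF assms closedin_chain_relation[OF assms] trans_chain_relation[OF assms]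
      chain_relation_superset[OF assms]])

text \<open>A function that increases along \<open>f\<close> can only decrease at the jumps of a chain.\<close>

lemma chain_below_monotone_bound:
  fixes L :: "'a \<Rightarrow> real"
  assumes "chain_below f d e x y" and f: "f \<subseteq> S \<times> S" and "x \<in> S" "y \<in> S"
    and mono: "\<And>a b. (a, b) \<in> f \<Longrightarrow> L a \<le> L b"
    and d: "\<And>x y. x \<in> S \<Longrightarrow> y \<in> S \<Longrightarrow> L x - L y \<le> d x y"
  shows "L x - L y < e"
proof -
  from assms(1) have "x \<in> S \<longrightarrow> L x - L y < e"
  proof (induction rule: chain_below_induct)
    case (single a b e x)
    then show ?case using mono[OF single(1)] d[of x a] d[of b y] f \<open>y \<in> S\<close> by auto
  next
    case (Cons a b e x)
    then show ?case using mono[OF Cons(1)] d[of x a] f by auto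
  qed
  then show ?thesis using \<open>x \<in> S\<close> by simp
qed

section \<open>Lyapunov functions on invariant pieces\<close>

definition invariant_piece :: "'a topology \<Rightarrow> ('a \<times> 'a) set \<Rightarrow> 'a set \<Rightarrow> bool" where
  "invariant_piece X f Y \<longleftrightarrow>
     (\<exists>K. compact_exhaustion X K \<and> (\<Union>n. K n) = Y) \<and> closedin X Y \<and>
     f \<subseteq> Y \<times> Y \<union> (- Y) \<times> (- Y)"

lemma continuous_map_extend_clopen:
  fixes L :: "'a \<Rightarrow> real"
  assumes Y: "openin X Y" "closedin X Y" and L: "continuous_map (subtopology X Y) euclideanreal L"
  shows "continuous_map X euclideanreal (\<lambda>x. if x \<in> Y then L x else c)"
  unfolding continuous_map_upper_lower_semicontinuous_lt
proof (intro conjI allI)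
  fix a
  have "openin X {x \<in> topspace (subtopology X Y). a < L x}" "openin X {x \<in> topspace (subtopology X Y). L x < a}"
    using L Y(1) openin_trans_full unfolding continuous_map_upper_lower_semicontinuous_lt by blast+
  moreover have "openin X (topspace X - Y)" using Y(2) by blast
  ultimately have
    "openin X ({x \<in> topspace (subtopology X Y). a < L x} \<union> (if a < c then topspace X - Y else {}))"
    "openin X ({x \<in> topspace (subtopology X Y). L x < a} \<union> (if c < a then topspace X - Y else {}))"
    by auto
  moreover have "{x \<in> topspace X. a < (if x \<in> Y then L x else c)} =
      {x \<in> topspace (subtopology X Y). a < L x} \<union> (if a < c then topspace X - Y else {})"
    "{x \<in> topspace X. (if x \<in> Y then L x else c) < a} =
      {x \<in> topspace (subtopology X Y). L x < a} \<union> (if c < a then topspace X - Y else {})"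
    by auto
  ultimately show "openin X {x \<in> topspace X. a < (if x \<in> Y then L x else c)}"
    "openin X {x \<in> topspace X. (if x \<in> Y then L x else c) < a}"
    by simp_all
qed

lemma closedin_refl_closed_trancl:
  assumes X: "Hausdorff_space X" and f: "f \<subseteq> topspace X \<times> topspace X"
  shows "closedin (prod_topology X X) (Id_on (topspace X) \<union> closed_trancl X f)"
proof -
  have "Id_on (topspace X) = (\<lambda>x. (x, x)) ` topspace X" by (auto simp: Id_on_def)
  then show ?thesis
    using X closed_trancl_least(1)[OF f] unfolding Hausdorff_space_closedin_diagonal
    by (simp add: closedin_Un)
qed

lemma Lyapunov_function:
  assumes X: "Hausdorff_space X" and f: "f \<subseteq> topspace X \<times> topspace X"
    and Y: "invariant_piece X f Y" and y: "y \<in> Y" and P: "compactin X P"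
    and Py: "\<And>p. p \<in> P \<Longrightarrow> (p, y) \<notin> Id_on (topspace X) \<union> closed_trancl X f"
  obtains L :: "'a \<Rightarrow> real" where "continuous_map X euclideanreal L" "\<And>x. 0 \<le> L x" "\<And>x. L x \<le> 1"
    "\<And>a b. (a, b) \<in> f \<Longrightarrow> L a \<le> L b" "L y = 0" "\<And>x. x \<in> P \<Longrightarrow> L x = 1"
proof -
  let ?R = "Id_on (topspace X) \<union> closed_trancl X f"
  obtain K where K: "compact_exhaustion X K" "(\<Union>n. K n) = Y"
    and clo: "closedin X Y" and inv: "f \<subseteq> Y \<times> Y \<union> (- Y) \<times> (- Y)"
    using Y by (auto simp: invariant_piece_def)
  have ope: "openin X Y" using openin_Union_exhaustion[OF K(1)] K(2) by simp
  have YX: "Y \<subseteq> topspace X" using closedin_subset[OF clo] .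
  have transG: "trans (closed_trancl X f)" using closed_trancl_least(2)[OF f] .
  interpret exhausted_preorder "subtopology X Y" "?R \<inter> Y \<times> Y" K
  proof
    show "Hausdorff_space (subtopology X Y)" using X by (rule Hausdorff_space_subtopology)
    show "compact_exhaustion (subtopology X Y) K"
      using K by (intro compact_exhaustion_subtopology) auto
    show "(\<Union>n. K n) = topspace (subtopology X Y)" using K(2) YX by auto
    show "closedin (prod_topology (subtopology X Y) (subtopology X Y)) (?R \<inter> Y \<times> Y)"
      unfolding subtopology_Times[symmetric] closedin_subtopology
      using closedin_refl_closed_trancl[OF X f] by blast
    show "(x, x) \<in> ?R \<inter> Y \<times> Y" if "x \<in> topspace (subtopology X Y)" for x
      using that by auto
    show "(x, z) \<in> ?R \<inter> Y \<times> Y" if "(x, y) \<in> ?R \<inter> Y \<times> Y" "(y, z) \<in> ?R \<inter> Y \<times> Y" for x y z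
      using that transD[OF transG] by auto
  qed
  have "compactin (subtopology X Y) (P \<inter> Y)"
    using P clo by (simp add: compactin_subtopology compact_Int_closedin)
  moreover have "y \<in> topspace (subtopology X Y)" using y YX by auto
  moreover have "(p, y) \<notin> ?R \<inter> Y \<times> Y" if "p \<in> P \<inter> Y" for p using Py that by blast
  ultimately show thesis
  proof (rule monotone_function_separating)
    fix L :: "'a \<Rightarrow> real"
    assume L: "continuous_map (subtopology X Y) euclideanreal L" "\<And>x. 0 \<le> L x" "\<And>x. L x \<le> 1"
      "\<And>x y. (x, y) \<in> ?R \<inter> Y \<times> Y \<Longrightarrow> L x \<le> L y" "L y = 0" "\<And>x. x \<in> P \<inter> Y \<Longrightarrow> L x = 1"
    show thesis
    proof (rule that)
      let ?L = "\<lambda>x. if x \<in> Y then L x else 1"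
      show "continuous_map X euclideanreal ?L"
        using continuous_map_extend_clopen[OF ope clo L(1)] .
      show "?L a \<le> ?L b" if ab: "(a, b) \<in> f" for a b
      proof (cases "a \<in> Y")
        case True
        then have "b \<in> Y" using inv ab by auto
        moreover have "(a, b) \<in> closed_trancl X f" using closed_trancl_least(3)[OF f] ab by auto
        ultimately show ?thesis using L(4)[of a b] True by simp
      next
        case False
        then have "b \<notin> Y" using inv ab by auto
        then show ?thesis using False by simp
      qed
    qed (use L y in auto)
  qed
qed

lemma chain_relation_subset_refl_closed_trancl:
  assumes X: "Hausdorff_space X" and f: "f \<subseteq> topspace X \<times> topspace X"
    and pieces: "\<And>y. y \<in> topspace X \<Longrightarrow> \<exists>Y. y \<in> Y \<and> invariant_piece X f Y"
  shows "chain_relation (topspace X) (diagonal_nbhds X) f \<subseteq> Id_on (topspace X) \<union> closed_trancl X f"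
proof (rule subrelI, rule ccontr)
  fix x y
  assume A: "(x, y) \<in> chain_relation (topspace X) (diagonal_nbhds X) f"
    and no: "(x, y) \<notin> Id_on (topspace X) \<union> closed_trancl X f"
  have xy: "x \<in> topspace X" "y \<in> topspace X" using A by (auto simp: chain_relation_def)
  obtain Y where Y: "y \<in> Y" "invariant_piece X f Y" using pieces xy by blast
  have "compactin X {x}" using xy by simp
  then show False
  proof (rule Lyapunov_function[OF X f Y(2,1)])
    show "(p, y) \<notin> Id_on (topspace X) \<union> closed_trancl X f" if "p \<in> {x}" for p using that no by simp
    fix L :: "'a \<Rightarrow> real"
    assume L: "continuous_map X euclideanreal L" "\<And>x. 0 \<le> L x" "\<And>x. L x \<le> 1"
      "\<And>a b. (a, b) \<in> f \<Longrightarrow> L a \<le> L b" "L y = 0" "\<And>z. z \<in> {x} \<Longrightarrow> L z = 1"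
    let ?d = "\<lambda>u v. \<bar>L u - L v\<bar>"
    have "?d \<in> gage (topspace X) (diagonal_nbhds X)"
      using L(2,3) by (intro gage_abs_diff[OF L(1), of 1]) (simp add: abs_le_iff order.trans[of _ 0])
    then have "chain_below f ?d 1 x y" using A by (simp add: chain_relation_eq)
    then have "L x - L y < 1"
      by (rule chain_below_monotone_bound[OF _ f xy]) (use L(4) in auto)
    then show False using L(5) L(6)[of x] by simp
  qed
qed

lemma chain_below_first:
  assumes "chain_below f d e x y"
  shows "\<exists>a b. (a, b) \<in> f \<and> (d x a + d b y < e \<or> chain_below f d (e - d x a) b y)"
  using assms by (induction rule: chain_below_induct) blast+

text \<open>If \<open>f\<close> is upper semicontinuous, the first link of a short chain from \<open>x\<close> lands close to the
  compact set \<open>f(x)\<close>, so that a Lyapunov function separating \<open>f(x)\<close> from \<open>x\<close> rules out a return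
  to \<open>x\<close>.\<close>

lemma chain_relation_diagonal_cusc:
  assumes X: "Hausdorff_space X" "locally_compact_space X" and f: "f \<subseteq> topspace X \<times> topspace X"
    and pieces: "\<And>y. y \<in> topspace X \<Longrightarrow> \<exists>Y. y \<in> Y \<and> invariant_piece X f Y"
    and cusc: "cusc X f" and A: "(x, x) \<in> chain_relation (topspace X) (diagonal_nbhds X) f"
  shows "(x, x) \<in> closed_trancl X f"
proof (rule ccontr)
  assume no: "(x, x) \<notin> closed_trancl X f"
  note G = closed_trancl_least(2,3)[OF f]
  have x: "x \<in> topspace X" using A by (auto simp: chain_relation_def)
  obtain Y where Y: "x \<in> Y" "invariant_piece X f Y" using pieces x by blast
  have "compactin X (f `` {x})" using cusc x by (simp add: cusc_def)
  then show False
  proof (rule Lyapunov_function[OF X(1) f Y(2,1)])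
    show "(p, x) \<notin> Id_on (topspace X) \<union> closed_trancl X f" if "p \<in> f `` {x}" for p
    proof
      assume p: "(p, x) \<in> Id_on (topspace X) \<union> closed_trancl X f"
      have "(x, p) \<in> closed_trancl X f" using that G(2) by auto
      then show False using p no transD[OF G(1)] by auto
    qed
    fix L :: "'a \<Rightarrow> real"
    assume L: "continuous_map X euclideanreal L" "\<And>x. 0 \<le> L x" "\<And>x. L x \<le> 1"
      "\<And>a b. (a, b) \<in> f \<Longrightarrow> L a \<le> L b" "L x = 0" "\<And>p. p \<in> f `` {x} \<Longrightarrow> L p = 1"
    define W where "W = {u \<in> topspace X. L u \<le> 1 / 2}"
    have "closedin X W"
      using L(1) unfolding continuous_map_upper_lower_semicontinuous_le W_def by blast
    then have "closedin X (f\<inverse> `` W)" using cusc by (simp add: cusc_def)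
    moreover have "x \<notin> f\<inverse> `` W" using L(6) by (force simp: W_def)
    moreover have "completely_regular_space X"
      using X by (simp add: locally_compact_regular_imp_completely_regular_space)
    ultimately obtain g :: "'a \<Rightarrow> real" where g: "continuous_map X (top_of_set {0..1}) g" "g x = 0"
      "g ` (f\<inverse> `` W) \<subseteq> {1}"
      using x unfolding completely_regular_space_def by (metis Diff_iff)
    have g01: "g u \<in> {0..1}" if "u \<in> topspace X" for u
      using g(1) that by (auto simp: continuous_map_in_subtopology)
    have gc: "continuous_map X euclideanreal g" using g(1) by (simp add: continuous_map_in_subtopology)
    let ?d = "\<lambda>u v. \<bar>L u - L v\<bar> + \<bar>g u - g v\<bar>"
    have "(\<lambda>u v. \<bar>L u - L v\<bar>) \<in> gage (topspace X) (diagonal_nbhds X)"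
      using L(2,3) by (intro gage_abs_diff[OF L(1), of 1]) (simp add: abs_le_iff order.trans[of _ 0])
    moreover have "(\<lambda>u v. \<bar>g u - g v\<bar>) \<in> gage (topspace X) (diagonal_nbhds X)"
      using g01 by (intro gage_abs_diff[OF gc, of 1]) auto
    ultimately have "?d \<in> gage (topspace X) (diagonal_nbhds X)" by (rule gage_add)
    then have "chain_below f ?d (1 / 2) x x" using A by (simp add: chain_relation_eq)
    from chain_below_first[OF this] obtain a b where ab: "(a, b) \<in> f"
      and short: "?d x a + ?d b x < 1 / 2 \<or> chain_below f ?d (1 / 2 - ?d x a) b x"
      by (elim exE conjE)
    have b: "b \<in> topspace X" using f ab by auto
    have "L b - L x < 1 / 2 - ?d x a" if "chain_below f ?d (1 / 2 - ?d x a) b x"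
      by (rule chain_below_monotone_bound[OF that f b x]) (use L(4) in auto)
    moreover have "L b - L x < 1 / 2 - ?d x a" if "?d x a + ?d b x < 1 / 2"
      using that abs_ge_self[of "L b - L x"] abs_ge_zero[of "g b - g x"] by linarith
    ultimately have Lb: "L b < 1 / 2 - ?d x a" using short L(5) by auto
    then have "\<bar>g x - g a\<bar> < 1 / 2" using L(2)[of b] abs_ge_zero[of "L x - L a"] by linarith
    then have "g a \<noteq> 1" using g(2) by auto
    then have "a \<notin> f\<inverse> `` W" using g(3) by blast
    then have "L b > 1 / 2" using ab b by (auto simp: W_def)
    then show False using Lb abs_ge_zero[of "L x - L a"] abs_ge_zero[of "g x - g a"] by linarith
  qed
qed

lemma chain_relation_eq_closed_trancl:
  assumes X: "Hausdorff_space X" "locally_compact_space X" and f: "f \<subseteq> topspace X \<times> topspace X"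
    and pieces: "\<And>y. y \<in> topspace X \<Longrightarrow> \<exists>Y. y \<in> Y \<and> invariant_piece X f Y"
    and cusc: "cusc X f"
  shows "closed_trancl X f = chain_relation (topspace X) (diagonal_nbhds X) f"
proof
  show "closed_trancl X f \<subseteq> chain_relation (topspace X) (diagonal_nbhds X) f"
    by (rule closed_trancl_subset_chain_relation[OF f])
  show "chain_relation (topspace X) (diagonal_nbhds X) f \<subseteq> closed_trancl X f"
  proof (rule subrelI)
    fix x y assume A: "(x, y) \<in> chain_relation (topspace X) (diagonal_nbhds X) f"
    then have "(x, y) \<in> Id_on (topspace X) \<union> closed_trancl X f"
      using chain_relation_subset_refl_closed_trancl[OF X(1) f pieces] by blast
    then show "(x, y) \<in> closed_trancl X f"
      using A chain_relation_diagonal_cusc[OF X f pieces cusc] by auto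
  qed
qed

section \<open>Invariant pieces of proper relations\<close>

lemma cusc_image_compact:
  assumes f: "f \<subseteq> topspace X \<times> topspace X" and cusc: "cusc X f" and C: "compactin X C"
  shows "compactin X (f `` C)"
  unfolding compactin_def
proof (intro conjI allI impI)
  show "f `` C \<subseteq> topspace X" using f by auto
  fix \<U> assume \<U>: "Ball \<U> (openin X) \<and> f `` C \<subseteq> \<Union>\<U>"
  define \<V> where "\<V> = {V. openin X V \<and> (\<exists>\<F>. finite \<F> \<and> \<F> \<subseteq> \<U> \<and> f `` V \<subseteq> \<Union>\<F>)}"
  have "C \<subseteq> \<Union>\<V>"
  proof
    fix x assume x: "x \<in> C"
    then have xX: "x \<in> topspace X" using compactin_subset_topspace[OF C] by auto
    then have "compactin X (f `` {x})" using cusc by (simp add: cusc_def)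
    moreover have "f `` {x} \<subseteq> \<Union>\<U>" using \<U> x by blast
    ultimately obtain \<F> where \<F>: "finite \<F>" "\<F> \<subseteq> \<U>" "f `` {x} \<subseteq> \<Union>\<F>"
      using \<U> unfolding compactin_def by metis
    have "openin X (\<Union>\<F>)" using \<F>(2) \<U> by blast
    then have "closedin X (topspace X - \<Union>\<F>)" by blast
    then have "closedin X (f\<inverse> `` (topspace X - \<Union>\<F>))" using cusc by (simp add: cusc_def)
    then have open_U: "openin X (topspace X - f\<inverse> `` (topspace X - \<Union>\<F>))" (is "openin X ?U")
      by blast
    have "f `` ?U \<subseteq> \<Union>\<F>"
    proof
      fix v assume "v \<in> f `` ?U"
      then obtain u where "(u, v) \<in> f" "u \<notin> f\<inverse> `` (topspace X - \<Union>\<F>)" by auto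
      moreover from this have "v \<in> topspace X" using f by auto
      ultimately show "v \<in> \<Union>\<F>" by auto
    qed
    then have "?U \<in> \<V>"
      unfolding \<V>_def mem_Collect_eq using \<F>(1,2) open_U by (intro conjI exI[of _ \<F>])
    moreover have "x \<in> ?U"
      using xX \<F>(3) by (auto simp: subset_iff)
    ultimately show "x \<in> \<Union>\<V>" by (rule UnionI)
  qed
  moreover have "openin X V" if "V \<in> \<V>" for V using that by (simp add: \<V>_def)
  ultimately obtain \<V>' where \<V>': "finite \<V>'" "\<V>' \<subseteq> \<V>" "C \<subseteq> \<Union>\<V>'"
    using compactinD[OF C, of \<V>] by blast
  have "\<forall>V\<in>\<V>'. \<exists>\<F>. finite \<F> \<and> \<F> \<subseteq> \<U> \<and> f `` V \<subseteq> \<Union>\<F>" using \<V>'(2) unfolding \<V>_def by blast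
  then obtain F where F: "\<forall>V\<in>\<V>'. finite (F V) \<and> F V \<subseteq> \<U> \<and> f `` V \<subseteq> \<Union>(F V)"
    by (rule bchoice[THEN exE])
  have "finite (\<Union>(F ` \<V>'))" "\<Union>(F ` \<V>') \<subseteq> \<U>" using F \<V>'(1) by auto
  moreover have "f `` C \<subseteq> \<Union>(\<Union>(F ` \<V>'))"
  proof
    fix y assume "y \<in> f `` C"
    then obtain x V where "(x, y) \<in> f" "x \<in> V" "V \<in> \<V>'" using \<V>'(3) by blast
    moreover from this have "y \<in> \<Union>(F V)" using F by blast
    ultimately show "y \<in> \<Union>(\<Union>(F ` \<V>'))" by blast
  qed
  ultimately show "\<exists>\<F>. finite \<F> \<and> \<F> \<subseteq> \<U> \<and> f `` C \<subseteq> \<Union>\<F>" by blast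
qed

lemma locally_finite_in_compact:
  assumes V: "locally_finite_in X \<V>" and C: "compactin X C"
  shows "finite {V \<in> \<V>. V \<inter> C \<noteq> {}}"
proof -
  define \<W> where "\<W> = {W. openin X W \<and> finite {V \<in> \<V>. V \<inter> W \<noteq> {}}}"
  have "C \<subseteq> \<Union>\<W>"
    using V compactin_subset_topspace[OF C] unfolding locally_finite_in_def \<W>_def by blast
  then obtain \<W>' where W: "finite \<W>'" "\<W>' \<subseteq> \<W>" "C \<subseteq> \<Union>\<W>'"
    using compactinD[OF C, of \<W>] unfolding \<W>_def by blast
  have "{V \<in> \<V>. V \<inter> C \<noteq> {}} \<subseteq> (\<Union>W\<in>\<W>'. {V \<in> \<V>. V \<inter> W \<noteq> {}})" using W(3) by blast
  moreover have "finite (\<Union>W\<in>\<W>'. {V \<in> \<V>. V \<inter> W \<noteq> {}})" using W(1,2) unfolding \<W>_def by auto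
  ultimately show ?thesis by (rule finite_subset)
qed

lemma paracompact_locally_compact_cover:
  assumes "paracompact_space X" "locally_compact_space X" and X: "Hausdorff_space X"
  shows "\<exists>\<V>. (\<forall>V\<in>\<V>. openin X V \<and> compactin X (X closure_of V)) \<and> \<Union>\<V> = topspace X \<and>
    locally_finite_in X \<V>"
proof -
  define \<U> where "\<U> = {U. openin X U \<and> (\<exists>K. compactin X K \<and> U \<subseteq> K)}"
  have "\<Union>\<U> = topspace X"
  proof
    show "topspace X \<subseteq> \<Union>\<U>"
      using assms(2) unfolding locally_compact_space_def \<U>_def by blast
  qed (auto simp: \<U>_def dest: openin_subset)
  then obtain \<V> where V: "\<forall>V\<in>\<V>. openin X V" "\<Union>\<V> = topspace X" "\<forall>V\<in>\<V>. \<exists>U\<in>\<U>. V \<subseteq> U" "locally_finite_in X \<V>"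
    using assms(1)[unfolded paracompact_space_def, rule_format, of \<U>] unfolding \<U>_def by blast
  have "compactin X (X closure_of V)" if VV: "V \<in> \<V>" for V
  proof -
    obtain U where "U \<in> \<U>" "V \<subseteq> U" using bspec[OF V(3) VV] ..
    then obtain K where K: "compactin X K" "V \<subseteq> K" unfolding \<U>_def by auto
    then have "X closure_of V \<subseteq> K"
      by (intro closure_of_minimal) (auto intro: compactin_imp_closedin[OF X])
    then show ?thesis by (rule closed_compactin[OF K(1)]) simp
  qed
  then show ?thesis using V by blast
qed

lemma proper_relation_invariant_piece:
  assumes X: "paracompact_space X" "locally_compact_space X" "Hausdorff_space X"
    and f: "f \<subseteq> topspace X \<times> topspace X" and proper: "proper_relation X f" and y: "y \<in> topspace X"
  shows "\<exists>Y. y \<in> Y \<and> invariant_piece X f Y"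
proof -
  obtain \<V> where \<V>: "\<forall>V\<in>\<V>. openin X V \<and> compactin X (X closure_of V)"
    and V: "\<Union>\<V> = topspace X" "locally_finite_in X \<V>"
    using paracompact_locally_compact_cover[OF X] by (elim exE conjE)
  have Vo: "openin X V" and Vc: "compactin X (X closure_of V)" if "V \<in> \<V>" for V
    using \<V> that by auto
  define T where "T C = f `` C \<union> f\<inverse> `` C \<union> \<Union>((closure_of) X ` {V \<in> \<V>. V \<inter> C \<noteq> {}})" for C
  have T_compact: "compactin X (T C)" if C: "compactin X C" for C
  proof -
    have "compactin X (f `` C)" "compactin X (f\<inverse> `` C)"
      using proper f C by (auto simp: proper_relation_def intro!: cusc_image_compact)
    moreover have "compactin X (\<Union>((closure_of) X ` {V \<in> \<V>. V \<inter> C \<noteq> {}}))"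
      using locally_finite_in_compact[OF V(2) C] Vc by (intro compactin_Union) auto
    ultimately show ?thesis unfolding T_def by (intro compactin_Un)
  qed
  have V_T: "V \<subseteq> T C" if "V \<in> \<V>" "V \<inter> C \<noteq> {}" for V C
    using closure_of_subset[OF openin_subset[OF Vo[OF that(1)]]] that unfolding T_def by blast
  define K where "K n = (T ^^ n) {y}" for n
  have KSuc: "K (Suc n) = T (K n)" for n by (simp add: K_def)
  have Kc: "compactin X (K n)" for n
    by (induction n) (use y T_compact KSuc in \<open>auto simp: K_def\<close>)
  have "\<exists>U. openin X U \<and> K n \<subseteq> U \<and> U \<subseteq> K (Suc n)" for n
  proof (intro exI conjI)
    show "openin X (\<Union>{V \<in> \<V>. V \<inter> K n \<noteq> {}})" using Vo by blast
    show "K n \<subseteq> \<Union>{V \<in> \<V>. V \<inter> K n \<noteq> {}}" using compactin_subset_topspace[OF Kc[of n]] V(1) by blast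
    show "\<Union>{V \<in> \<V>. V \<inter> K n \<noteq> {}} \<subseteq> K (Suc n)" unfolding KSuc by (intro Union_least) (use V_T in blast)
  qed
  then have "compact_exhaustion X K" using Kc by (simp add: compact_exhaustion_def)
  moreover have "closedin X (\<Union>n. K n)"
  proof -
    have "topspace X - (\<Union>n. K n) = \<Union>{V \<in> \<V>. V \<inter> (\<Union>n. K n) = {}}"
    proof
      show "topspace X - (\<Union>n. K n) \<subseteq> \<Union>{V \<in> \<V>. V \<inter> (\<Union>n. K n) = {}}"
      proof
        fix x assume x: "x \<in> topspace X - (\<Union>n. K n)"
        then obtain W where W: "W \<in> \<V>" "x \<in> W" using V(1) by blast
        have "W \<inter> K n = {}" for n
        proof (rule ccontr)
          assume "W \<inter> K n \<noteq> {}"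
          then have "x \<in> K (Suc n)" using V_T[OF W(1)] W(2) KSuc by auto
          then show False using x by blast
        qed
        then show "x \<in> \<Union>{V \<in> \<V>. V \<inter> (\<Union>n. K n) = {}}" using W by blast
      qed
    qed (use V(1) in blast)
    moreover have "openin X (\<Union>{V \<in> \<V>. V \<inter> (\<Union>n. K n) = {}})" using Vo by blast
    moreover have "(\<Union>n. K n) \<subseteq> topspace X" using compactin_subset_topspace[OF Kc] by blast
    ultimately show ?thesis by (simp add: closedin_def)
  qed
  moreover have "f \<subseteq> (\<Union>n. K n) \<times> (\<Union>n. K n) \<union> (- (\<Union>n. K n)) \<times> (- (\<Union>n. K n))"
  proof (rule subrelI)
    fix a b assume ab: "(a, b) \<in> f"
    have "b \<in> K (Suc n)" if "a \<in> K n" for n using ab that unfolding KSuc T_def by blast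
    moreover have "a \<in> K (Suc n)" if "b \<in> K n" for n using ab that unfolding KSuc T_def by blast
    ultimately show "(a, b) \<in> (\<Union>n. K n) \<times> (\<Union>n. K n) \<union> (- (\<Union>n. K n)) \<times> (- (\<Union>n. K n))" by blast
  qed
  moreover have "y \<in> (\<Union>n. K n)" by (rule UN_I[of 0]) (simp_all add: K_def)
  ultimately show ?thesis unfolding invariant_piece_def by blast
qed

theorem corollary6p15:
  fixes X :: "'a topology" and f :: "('a \<times> 'a) set"
  assumes "paracompact_space X" and "locally_compact_space X" and "Hausdorff_space X"
    and "f \<subseteq> topspace X \<times> topspace X"
  shows
    "(sigma_compact_space X \<longrightarrow>
        Id_on (topspace X) \<union> closed_trancl X f =
          Id_on (topspace X) \<union> chain_relation (topspace X) (diagonal_nbhds X) f \<and>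
        (cusc X f \<longrightarrow>
          closed_trancl X f = chain_relation (topspace X) (diagonal_nbhds X) f)) \<and>
     (proper_relation X f \<longrightarrow>
        closed_trancl X f = chain_relation (topspace X) (diagonal_nbhds X) f)"
proof (rule conjI; rule impI)
  assume sigma: "sigma_compact_space X"
  have pieces: "\<exists>Y. y \<in> Y \<and> invariant_piece X f Y" if y: "y \<in> topspace X" for y
  proof -
    obtain K where "compact_exhaustion X K" "(\<Union>n. K n) = topspace X"
      using sigma_compact_imp_compact_exhaustion[OF assms(2,3) sigma] .
    then have "invariant_piece X f (topspace X)" using assms(4) by (auto simp: invariant_piece_def)
    then show ?thesis using y by blast
  qed
  have "closed_trancl X f \<subseteq> chain_relation (topspace X) (diagonal_nbhds X) f"
    by (rule closed_trancl_subset_chain_relation[OF assms(4)])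
  moreover have "chain_relation (topspace X) (diagonal_nbhds X) f \<subseteq> Id_on (topspace X) \<union> closed_trancl X f"
    by (rule chain_relation_subset_refl_closed_trancl[OF assms(3,4) pieces])
  ultimately have "Id_on (topspace X) \<union> closed_trancl X f =
      Id_on (topspace X) \<union> chain_relation (topspace X) (diagonal_nbhds X) f" by blast
  moreover have "closed_trancl X f = chain_relation (topspace X) (diagonal_nbhds X) f" if "cusc X f"
    by (rule chain_relation_eq_closed_trancl[OF assms(3,2,4) pieces that])
  ultimately show "Id_on (topspace X) \<union> closed_trancl X f =
          Id_on (topspace X) \<union> chain_relation (topspace X) (diagonal_nbhds X) f \<and>
        (cusc X f \<longrightarrow>
          closed_trancl X f = chain_relation (topspace X) (diagonal_nbhds X) f)" by blast
next
  assume proper: "proper_relation X f"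
  show "closed_trancl X f = chain_relation (topspace X) (diagonal_nbhds X) f"
    by (rule chain_relation_eq_closed_trancl[OF assms(3,2,4) proper_relation_invariant_piece])
      (use assms proper in \<open>auto simp: proper_relation_def\<close>)
qed

end
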